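(* Let $(E,\tau,\preceq_C)$ be an ordered topological vector space whose cone $C$ is solid. Then there exists a norm on $E$, of the form $\|\cdot\|_e$ with $e\in\operatorname{int}_\tau C$, which is monotone with respect to $C$ (that is, $\theta\preceq_C x\preceq_C y$ implies $\|x\|_e\le\|y\|_e$) and such that $C$ is a normal and solid cone in the normed space $(E,\|\cdot\|_e)$. In particular, the set of interior points of $C$ with respect to $\tau$ coincides with the set of interior points of $C$ with respect to the topology generated by $\|\cdot\|_e$.
   Context: $E$ is a real vector space with zero vector $\theta$, and $\tau$ is a vector topology on $E$ (addition and scalar multiplication are continuous; Hausdorffness is not assumed). A subset $C\subset E$ is a cone if: (1) $C$ is closed, nonempty and $C\neq\{\theta\}$; (2) $x,y\in C$ and $\lambda,\mu\ge 0$ imply $\lambda x+\mu y\in C$; (3) $C\cap(-C)=\{\theta\}$. It induces the partial order $x\preceq_C y\iff y-x\in C$; the triple $(E,\tau,\preceq_C)$ is called an ordered topological vector space. The cone is solid if its interior (in the topology under consideration) is nonempty. A cone $C$ in a normed space $(E,\|\cdot\|)$ is normal if there is a number $K$ such that $\theta\preceq_C x\preceq_C y$ implies $\|x\|\le K\|y\|$. For $e\in\operatorname{int}_\tau C$, put $[-e,e]=\{z\in E\mid -e\preceq_C z\preceq_C e\}$ and let $\|\cdot\|_e$ be its Minkowski functional, $\|x\|_e=\inf\{\lambda>0\mid x\in\lambda[-e,e]\}$. *)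

theory Defs
  imports "HOL-Analysis.Analysis"
begin

text \<open>The topology is an explicit parameter (not a type class instance), since the statement
  compares two topologies on the same vector space. Hausdorffness is not required.\<close>

definition vector_topology :: "'a::real_vector topology \<Rightarrow> bool" where
  "vector_topology T \<longleftrightarrow>
     topspace T = UNIV \<and>
     continuous_map (prod_topology T T) T (\<lambda>(x, y). x + y) \<and>
     continuous_map (prod_topology euclideanreal T) T (\<lambda>(c, x). c *\<^sub>R x)"

text \<open>Not to be confused with the library constant \<open>cone\<close>, which only asks for closure under
  nonnegative scaling.\<close>

definition ordering_cone :: "'a::real_vector topology \<Rightarrow> 'a set \<Rightarrow> bool" where
  "ordering_cone T C \<longleftrightarrow>
     closedin T C \<and> C \<noteq> {} \<and> C \<noteq> {0} \<and>
     (\<forall>x\<in>C. \<forall>y\<in>C. \<forall>l\<ge>0. \<forall>m\<ge>0. l *\<^sub>R x + m *\<^sub>R y \<in> C) \<and>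
     C \<inter> uminus ` C = {0}"

definition cone_le :: "'a::real_vector set \<Rightarrow> 'a \<Rightarrow> 'a \<Rightarrow> bool" where
  "cone_le C x y \<longleftrightarrow> y - x \<in> C"

definition ordered_tvs :: "'a::real_vector topology \<Rightarrow> 'a set \<Rightarrow> bool" where
  "ordered_tvs T C \<longleftrightarrow> vector_topology T \<and> ordering_cone T C"

definition solid :: "'a::real_vector topology \<Rightarrow> 'a set \<Rightarrow> bool" where
  "solid T C \<longleftrightarrow> T interior_of C \<noteq> {}"

definition is_norm :: "('a::real_vector \<Rightarrow> real) \<Rightarrow> bool" where
  "is_norm N \<longleftrightarrow>
     (\<forall>x. 0 \<le> N x) \<and> (\<forall>x. N x = 0 \<longleftrightarrow> x = 0) \<and>
     (\<forall>c x. N (c *\<^sub>R x) = \<bar>c\<bar> * N x) \<and>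
     (\<forall>x y. N (x + y) \<le> N x + N y)"

definition norm_topology :: "('a::real_vector \<Rightarrow> real) \<Rightarrow> 'a topology" where
  "norm_topology N = Metric_space.mtopology UNIV (\<lambda>x y. N (x - y))"

definition monotone_norm :: "'a::real_vector set \<Rightarrow> ('a \<Rightarrow> real) \<Rightarrow> bool" where
  "monotone_norm C N \<longleftrightarrow> (\<forall>x y. cone_le C 0 x \<and> cone_le C x y \<longrightarrow> N x \<le> N y)"

definition normal :: "('a::real_vector \<Rightarrow> real) \<Rightarrow> 'a set \<Rightarrow> bool" where
  "normal N C \<longleftrightarrow> (\<exists>K. \<forall>x y. cone_le C 0 x \<and> cone_le C x y \<longrightarrow> N x \<le> K * N y)"

definition order_interval :: "'a::real_vector set \<Rightarrow> 'a \<Rightarrow> 'a \<Rightarrow> 'a set" where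
  "order_interval C a b = {z. cone_le C a z \<and> cone_le C z b}"

text \<open>The infimum is taken in \<^typ>\<open>real\<close>, so it is only meaningful when some positive multiple
  of \<open>S\<close> contains \<open>x\<close>; this holds for every \<open>x\<close> when \<open>S = [-e, e]\<close> with \<open>e\<close> interior to the cone.\<close>

definition minkowski_functional :: "'a::real_vector set \<Rightarrow> 'a \<Rightarrow> real" where
  "minkowski_functional S x = Inf {l. l > 0 \<and> x \<in> (\<lambda>z. l *\<^sub>R z) ` S}"

definition cone_norm :: "'a::real_vector set \<Rightarrow> 'a \<Rightarrow> 'a \<Rightarrow> real" where
  "cone_norm C e = minkowski_functional (order_interval C (- e) e)"

end

theory Submission
  imports Defs
begin

text \<open>An interior point \<open>e\<close> of \<open>C\<close> is an order unit, and \<open>C\<close> is closed along lines, so the infimum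
  defining \<open>\<parallel>x\<parallel>\<^sub>e\<close> is attained: for \<open>l \<ge> 0\<close>, \<open>\<parallel>x\<parallel>\<^sub>e \<le> l\<close> iff \<open>l e - x\<close> and \<open>l e + x\<close> both lie in \<open>C\<close>.
  The norm axioms, monotonicity and closedness of \<open>C\<close> are read off from this equivalence. Both
  interiors of \<open>C\<close> coincide with the set of all \<open>x\<close> such that \<open>x - d e \<in> C\<close> for some \<open>d > 0\<close>.\<close>

section \<open>Continuity of lines and affine maps, and the metric of a norm\<close>

lemma vector_topology_continuous_map_line:
  assumes "vector_topology T"
  shows "continuous_map euclideanreal T (\<lambda>t. a + t *\<^sub>R x)"
proof -
  have top: "topspace T = UNIV"
    and add: "continuous_map (prod_topology T T) T (\<lambda>(x, y). x + y)"
    and scale: "continuous_map (prod_topology euclideanreal T) T (\<lambda>(c, x). c *\<^sub>R x)"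
    using assms by (auto simp: vector_topology_def)
  have "continuous_map euclideanreal (prod_topology euclideanreal T) (\<lambda>t. (t, x))"
    by (simp add: continuous_map_paired top)
  from continuous_map_compose[OF this scale]
  have "continuous_map euclideanreal T (\<lambda>t. t *\<^sub>R x)"
    by (simp add: o_def)
  then have "continuous_map euclideanreal (prod_topology T T) (\<lambda>t. (a, t *\<^sub>R x))"
    by (simp add: continuous_map_paired top)
  from continuous_map_compose[OF this add] show ?thesis
    by (simp add: o_def)
qed

text \<open>With \<open>c = inverse d\<close>, this pulls the interior of the cone back to an open
  neighbourhood of another point.\<close>

lemma vector_topology_continuous_map_affine:
  assumes "vector_topology T"
  shows "continuous_map T T (\<lambda>x. c *\<^sub>R (x + a))"
proof -
  have top: "topspace T = UNIV"
    and add: "continuous_map (prod_topology T T) T (\<lambda>(x, y). x + y)"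
    and scale: "continuous_map (prod_topology euclideanreal T) T (\<lambda>(c, x). c *\<^sub>R x)"
    using assms by (auto simp: vector_topology_def)
  have "continuous_map T (prod_topology T T) (\<lambda>x. (x, a))"
    by (simp add: continuous_map_paired top)
  from continuous_map_compose[OF this add]
  have "continuous_map T T (\<lambda>x. x + a)"
    by (simp add: o_def)
  then have "continuous_map T (prod_topology euclideanreal T) (\<lambda>x. (c, x + a))"
    by (simp add: continuous_map_paired)
  from continuous_map_compose[OF this scale] show ?thesis
    by (simp add: o_def)
qed

lemma is_norm_imp_Metric_space:
  assumes "is_norm N"
  shows "Metric_space UNIV (\<lambda>x y. N (x - y))"
proof
  have scale: "N (c *\<^sub>R x) = \<bar>c\<bar> * N x" and tri: "N (x + y) \<le> N x + N y" for c x y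
    using assms by (auto simp: is_norm_def)
  show "0 \<le> N (x - y)" for x y
    using assms by (auto simp: is_norm_def)
  show "N (x - y) = N (y - x)" for x y
    using scale[of "-1" "x - y"] by simp
  show "N (x - y) = 0 \<longleftrightarrow> x = y" for x y
    using assms by (auto simp: is_norm_def)
  show "N (x - z) \<le> N (x - y) + N (y - z)" for x y z
    using tri[of "x - y" "y - z"] by simp
qed

section \<open>Cone arithmetic and order units\<close>

locale ordered_tvs_interior_point =
  fixes T :: "'a::real_vector topology" and C :: "'a set" and e :: 'a
  assumes ordered: "ordered_tvs T C"
    and interior: "e \<in> T interior_of C"
begin

lemma vector_topology: "vector_topology T"
  using ordered by (simp add: ordered_tvs_def)

lemma cone_closed: "closedin T C"
  using ordered by (simp add: ordered_tvs_def ordering_cone_def)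

lemma cone_combination:
  "x \<in> C \<Longrightarrow> y \<in> C \<Longrightarrow> 0 \<le> l \<Longrightarrow> 0 \<le> m \<Longrightarrow> l *\<^sub>R x + m *\<^sub>R y \<in> C"
  using ordered by (simp add: ordered_tvs_def ordering_cone_def)

lemma cone_add: "x \<in> C \<Longrightarrow> y \<in> C \<Longrightarrow> x + y \<in> C"
  using cone_combination[of x y 1 1] by simp

lemma cone_scale: "x \<in> C \<Longrightarrow> 0 \<le> l \<Longrightarrow> l *\<^sub>R x \<in> C"
  using cone_combination[of x x l 0] by simp

lemma cone_Int_uminus: "C \<inter> uminus ` C = {0}"
  using ordered by (simp add: ordered_tvs_def ordering_cone_def)

lemma zero_in_cone: "0 \<in> C"
  using cone_Int_uminus by blast

lemma cone_pointed:
  assumes "x \<in> C" "- x \<in> C"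
  shows "x = 0"
proof -
  have "x \<in> uminus ` C"
    using assms(2) by (rule rev_image_eqI) simp
  then show ?thesis
    using assms(1) cone_Int_uminus by blast
qed

lemma unit_in_cone: "e \<in> C"
  using interior interior_of_subset[of T C] by blast

text \<open>Closedness of \<open>C\<close> in \<open>T\<close> enters the argument only in this
  form, as a statement about subsets of the real line.\<close>

lemma cone_line_closed: "closed {t. a + t *\<^sub>R x \<in> C}"
  using closedin_continuous_map_preimage
      [OF vector_topology_continuous_map_line[OF vector_topology] cone_closed]
  by simp

text \<open>The parameters \<open>t\<close> with \<open>x + t *\<^sub>R v\<close> interior form an
  open set of reals containing 0. An arbitrary direction \<open>v\<close> yields order units, and
  \<open>v = - e\<close> yields the description of the interior.\<close>

lemma interior_line:
  assumes "x \<in> T interior_of C"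
  obtains d where "0 < d" "x + d *\<^sub>R v \<in> C"
proof -
  have "open {t. x + t *\<^sub>R v \<in> T interior_of C}"
    using openin_continuous_map_preimage
        [OF vector_topology_continuous_map_line[OF vector_topology] openin_interior_of]
    by simp
  moreover have "0 \<in> {t. x + t *\<^sub>R v \<in> T interior_of C}"
    using assms by simp
  ultimately obtain d where "0 < d" "cball 0 d \<subseteq> {t. x + t *\<^sub>R v \<in> T interior_of C}"
    using open_contains_cball by blast
  then have "x + d *\<^sub>R v \<in> T interior_of C"
    by (auto simp: subset_iff)
  then show thesis
    using that \<open>0 < d\<close> interior_of_subset[of T C] by blast
qed

text \<open>If \<open>e + d *\<^sub>R v\<close> is in \<open>C\<close>, dividing by \<open>d\<close>
  absorbs \<open>v\<close>. Doing this for \<open>x\<close> and \<open>- x\<close> gives two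
  scalars; their sum serves both, because adding nonnegative multiples of \<open>e\<close> stays in
  \<open>C\<close>. Hence the infimum defining the norm is over a nonempty set.\<close>

lemma order_unit:
  obtains l where "0 < l" "l *\<^sub>R e - x \<in> C" "l *\<^sub>R e + x \<in> C"
proof -
  have absorb: "\<exists>l>0. l *\<^sub>R e + v \<in> C" for v
  proof -
    obtain d where d: "0 < d" "e + d *\<^sub>R v \<in> C"
      using interior_line[OF interior] by blast
    then have "inverse d *\<^sub>R (e + d *\<^sub>R v) \<in> C"
      by (intro cone_scale) auto
    with d show ?thesis
      by (intro exI[of _ "inverse d"]) (simp add: scaleR_add_right)
  qed
  obtain l m where lm: "0 < l" "l *\<^sub>R e + x \<in> C" "0 < m" "m *\<^sub>R e + - x \<in> C"
    using absorb by blast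
  show thesis
  proof (rule that[of "l + m"])
    show "0 < l + m"
      using lm by simp
    show "(l + m) *\<^sub>R e - x \<in> C"
      using cone_add[OF lm(4) cone_scale[OF unit_in_cone, of l]] lm
      by (simp add: algebra_simps)
    show "(l + m) *\<^sub>R e + x \<in> C"
      using cone_add[OF lm(2) cone_scale[OF unit_in_cone, of m]] lm
      by (simp add: algebra_simps)
  qed
qed

section \<open>The Minkowski functional as an attained infimum\<close>

lemma cone_norm_eq:
  "cone_norm C e x = Inf {l. 0 < l \<and> l *\<^sub>R e - x \<in> C \<and> l *\<^sub>R e + x \<in> C}"
proof -
  have "x \<in> (\<lambda>z. l *\<^sub>R z) ` order_interval C (- e) e \<longleftrightarrow> l *\<^sub>R e - x \<in> C \<and> l *\<^sub>R e + x \<in> C"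
    (is "?L \<longleftrightarrow> ?R") if l: "0 < l" for l
  proof
    assume ?L
    then obtain z where "x = l *\<^sub>R z" "z + e \<in> C" "e - z \<in> C"
      by (auto simp: order_interval_def cone_le_def)
    then show ?R
      using cone_scale[of "z + e" l] cone_scale[of "e - z" l] l
      by (simp add: algebra_simps)
  next
    assume R: ?R
    then have "inverse l *\<^sub>R (l *\<^sub>R e - x) \<in> C" "inverse l *\<^sub>R (l *\<^sub>R e + x) \<in> C"
      using l by (auto intro!: cone_scale)
    then have "inverse l *\<^sub>R x \<in> order_interval C (- e) e"
      using l by (simp add: order_interval_def cone_le_def algebra_simps)
    moreover have "x = l *\<^sub>R (inverse l *\<^sub>R x)"
      using l by simp
    ultimately show ?L
      by blast
  qed
  then show ?thesis
    unfolding cone_norm_def minkowski_functional_def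
    by (intro arg_cong[where f = Inf]) blast
qed

lemma cone_norm_nonneg: "0 \<le> cone_norm C e x"
  unfolding cone_norm_eq
proof (rule cInf_greatest)
  show "{l. 0 < l \<and> l *\<^sub>R e - x \<in> C \<and> l *\<^sub>R e + x \<in> C} \<noteq> {}"
    using order_unit[of x] by blast
qed auto

text \<open>Some admissible \<open>m\<close> lies below \<open>l\<close>, and admissible scalars are
  closed upwards since \<open>(l - m) *\<^sub>R e\<close> can be added.\<close>

lemma cone_norm_less_imp:
  assumes "cone_norm C e x < l"
  shows "l *\<^sub>R e - x \<in> C" "l *\<^sub>R e + x \<in> C"
proof -
  have "{l. 0 < l \<and> l *\<^sub>R e - x \<in> C \<and> l *\<^sub>R e + x \<in> C} \<noteq> {}"
    using order_unit[of x] by blast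
  from cInf_lessD[OF this assms[unfolded cone_norm_eq]]
  obtain m where m: "m < l" "m *\<^sub>R e - x \<in> C" "m *\<^sub>R e + x \<in> C"
    by blast
  then have "(l - m) *\<^sub>R e \<in> C"
    by (intro cone_scale unit_in_cone) simp
  from cone_add[OF m(2) this] cone_add[OF m(3) this]
  show "l *\<^sub>R e - x \<in> C" "l *\<^sub>R e + x \<in> C"
    by (simp_all add: algebra_simps)
qed

lemma cone_norm_attained: "cone_norm C e x *\<^sub>R e - x \<in> C" "cone_norm C e x *\<^sub>R e + x \<in> C"
proof -
  let ?n = "cone_norm C e x"
  have limit: "y + ?n *\<^sub>R e \<in> C" if "\<And>l. ?n < l \<Longrightarrow> y + l *\<^sub>R e \<in> C" for y
  proof -
    \<comment> \<open>The endpoint \<open>?n\<close> belongs to the closure of the open ray, so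
      closedness along the line passes membership to the limit.\<close>
    have "closure {?n<..} \<subseteq> {t. y + t *\<^sub>R e \<in> C}"
      using that by (intro closure_minimal cone_line_closed) auto
    then show ?thesis
      by auto
  qed
  show "?n *\<^sub>R e - x \<in> C"
    using limit[of "- x"] cone_norm_less_imp(1)[of x] by simp
  show "?n *\<^sub>R e + x \<in> C"
    using limit[of x] cone_norm_less_imp(2)[of x] by (simp add: add.commute)
qed

lemma cone_norm_le_iff:
  assumes "0 \<le> l"
  shows "cone_norm C e x \<le> l \<longleftrightarrow> l *\<^sub>R e - x \<in> C \<and> l *\<^sub>R e + x \<in> C" (is "_ \<longleftrightarrow> ?R")
proof
  assume "cone_norm C e x \<le> l"
  then have "(l - cone_norm C e x) *\<^sub>R e \<in> C"
    by (intro cone_scale unit_in_cone) simp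
  from cone_add[OF cone_norm_attained(1)[of x] this] cone_add[OF cone_norm_attained(2)[of x] this]
  show ?R
    by (simp add: algebra_simps)
next
  assume R: ?R
  show "cone_norm C e x \<le> l"
  \<comment> \<open>The infimum ranges over positive scalars only, so \<open>l = 0\<close> is not
    itself admissible; the slack \<open>d\<close> makes \<open>l + d\<close> admissible. The case
    \<open>l = 0\<close> is what later gives the zero vector norm 0.\<close>
  proof (rule field_le_epsilon)
    fix d :: real assume d: "0 < d"
    then have "d *\<^sub>R e \<in> C"
      by (intro cone_scale unit_in_cone) simp
    with R have "(l + d) *\<^sub>R e - x \<in> C" "(l + d) *\<^sub>R e + x \<in> C"
      using cone_add[of "l *\<^sub>R e - x" "d *\<^sub>R e"] cone_add[of "l *\<^sub>R e + x" "d *\<^sub>R e"]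
      by (simp_all add: algebra_simps)
    with assms d show "cone_norm C e x \<le> l + d"
      unfolding cone_norm_eq by (intro cInf_lower bdd_belowI[of _ 0]) auto
  qed
qed

section \<open>Norm axioms and monotonicity\<close>

lemma cone_norm_scale_le: "cone_norm C e (c *\<^sub>R x) \<le> \<bar>c\<bar> * cone_norm C e x"
proof -
  let ?n = "cone_norm C e x"
  have minus: "\<bar>c\<bar> *\<^sub>R (?n *\<^sub>R e - x) \<in> C" and plus: "\<bar>c\<bar> *\<^sub>R (?n *\<^sub>R e + x) \<in> C"
    by (intro cone_scale cone_norm_attained; simp)+
  have "(\<bar>c\<bar> * ?n) *\<^sub>R e - c *\<^sub>R x \<in> C \<and> (\<bar>c\<bar> * ?n) *\<^sub>R e + c *\<^sub>R x \<in> C"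
  proof (cases "0 \<le> c")
    case True
    then show ?thesis
      using minus plus by (simp add: scaleR_diff_right scaleR_add_right)
  next
    case False
    \<comment> \<open>A negative scalar exchanges the two membership conditions.\<close>
    then have "c *\<^sub>R x = - (\<bar>c\<bar> *\<^sub>R x)"
      by simp
    then show ?thesis
      using minus plus by (simp only: scaleR_diff_right scaleR_add_right scaleR_scaleR
          diff_minus_eq_add add_uminus_conv_diff simp_thms)
  qed
  then show ?thesis
    by (subst cone_norm_le_iff) (auto simp: cone_norm_nonneg)
qed

lemma is_norm_cone_norm: "is_norm (cone_norm C e)"
  unfolding is_norm_def
proof (intro conjI allI)
  fix x y and c :: real
  show "0 \<le> cone_norm C e x"
    by (rule cone_norm_nonneg)
  show "cone_norm C e x = 0 \<longleftrightarrow> x = 0"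
  proof
    assume "cone_norm C e x = 0"
    \<comment> \<open>Attainment at the value 0 puts both \<open>x\<close> and \<open>- x\<close> in
      \<open>C\<close>.\<close>
    then show "x = 0"
      using cone_norm_attained[of x] cone_pointed by auto
  next
    assume "x = 0"
    then show "cone_norm C e x = 0"
      using cone_norm_le_iff[of 0 x] cone_norm_nonneg[of x] zero_in_cone by simp
  qed
  show "cone_norm C e (c *\<^sub>R x) = \<bar>c\<bar> * cone_norm C e x"
  proof (cases "c = 0")
    case True
    then show ?thesis
      using cone_norm_scale_le[of c x] cone_norm_nonneg[of "c *\<^sub>R x"] by simp
  next
    case False
    \<comment> \<open>The reverse inequality is the first one applied to \<open>inverse c\<close>
      and \<open>c *\<^sub>R x\<close>.\<close>
    then have "\<bar>c\<bar> * cone_norm C e x \<le> cone_norm C e (c *\<^sub>R x)"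
      using cone_norm_scale_le[of "inverse c" "c *\<^sub>R x"]
      by (simp add: field_simps)
    then show ?thesis
      using cone_norm_scale_le[of c x] by simp
  qed
  show "cone_norm C e (x + y) \<le> cone_norm C e x + cone_norm C e y"
  proof -
    let ?l = "cone_norm C e x + cone_norm C e y"
    have "?l *\<^sub>R e - (x + y) \<in> C"
      using cone_add[OF cone_norm_attained(1)[of x] cone_norm_attained(1)[of y]]
      by (simp add: scaleR_add_left add_diff_add)
    moreover have "?l *\<^sub>R e + (x + y) \<in> C"
      using cone_add[OF cone_norm_attained(2)[of x] cone_norm_attained(2)[of y]]
      by (simp add: scaleR_add_left ac_simps)
    ultimately show ?thesis
      using cone_norm_le_iff[of ?l] cone_norm_nonneg by simp
  qed
qed

text \<open>Write \<open>n\<close> for the norm of \<open>y\<close>. Then \<open>x\<close> lies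
  below \<open>y\<close>, which lies below \<open>n *\<^sub>R e\<close>; and
  \<open>n *\<^sub>R e + x\<close> is a sum of two elements of \<open>C\<close>. So \<open>n\<close>
  is admissible for \<open>x\<close>.\<close>

lemma monotone_cone_norm: "monotone_norm C (cone_norm C e)"
  unfolding monotone_norm_def cone_le_def
proof (intro allI impI)
  fix x y assume "x - 0 \<in> C \<and> y - x \<in> C"
  then have "cone_norm C e y *\<^sub>R e - x \<in> C" "cone_norm C e y *\<^sub>R e + x \<in> C"
    using cone_add[OF cone_norm_attained(1)[of y], of "y - x"]
      cone_add[OF cone_scale[OF unit_in_cone cone_norm_nonneg[of y]], of x]
    by simp_all
  then show "cone_norm C e x \<le> cone_norm C e y"
    by (simp add: cone_norm_le_iff cone_norm_nonneg)
qed

section \<open>The norm topology and the two interiors\<close>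

sublocale cone_metric: Metric_space UNIV "\<lambda>x y. cone_norm C e (x - y)"
  by (rule is_norm_imp_Metric_space[OF is_norm_cone_norm])

text \<open>For \<open>x\<close> outside \<open>C\<close>, closedness along the line in direction
  \<open>e\<close> leaves some \<open>x + d *\<^sub>R e\<close> outside too. A point
  \<open>y\<close> of \<open>C\<close> at distance less than \<open>d\<close> from \<open>x\<close>
  would put it back, as the sum of \<open>d *\<^sub>R e + (x - y)\<close> and
  \<open>y\<close>.\<close>

lemma closedin_cone_norm: "closedin (norm_topology (cone_norm C e)) C"
  unfolding norm_topology_def cone_metric.closedin_metric
proof (intro conjI allI impI)
  fix x assume "x \<in> UNIV - C"
  then have "0 \<in> - {t. x + t *\<^sub>R e \<in> C}"
    by simp
  moreover have "open (- {t. x + t *\<^sub>R e \<in> C})"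
    using cone_line_closed by (rule open_Compl)
  ultimately obtain d where d: "0 < d" "cball 0 d \<subseteq> - {t. x + t *\<^sub>R e \<in> C}"
    using open_contains_cball by blast
  then have notin: "x + d *\<^sub>R e \<notin> C"
    by (auto simp: subset_iff)
  have "y \<notin> C" if "cone_norm C e (x - y) < d" for y
    using cone_norm_less_imp(2)[OF that] cone_add[of "d *\<^sub>R e + (x - y)" y] notin
    by (auto simp: add.commute)
  then show "\<exists>r>0. disjnt C (cone_metric.mball x r)"
    using d(1) by (auto simp: disjnt_def)
qed simp

lemma ordering_cone_norm_topology: "ordering_cone (norm_topology (cone_norm C e)) C"
  using ordered closedin_cone_norm by (simp add: ordered_tvs_def ordering_cone_def)

lemma interior_of_cone_eq: "T interior_of C = {x. \<exists>d>0. x - d *\<^sub>R e \<in> C}"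
proof (intro equalityI subsetI CollectI)
  fix x assume "x \<in> T interior_of C"
  then show "\<exists>d>0. x - d *\<^sub>R e \<in> C"
    using interior_line[of x "- e"] by auto
next
  fix x assume "x \<in> {x. \<exists>d>0. x - d *\<^sub>R e \<in> C}"
  then obtain d where d: "0 < d" "x - d *\<^sub>R e \<in> C"
    by blast
  let ?c = "x - d *\<^sub>R e"
  \<comment> \<open>This is the interior of \<open>C\<close> scaled by \<open>d\<close> and
    translated by \<open>?c\<close>. It contains \<open>x = ?c + d *\<^sub>R e\<close>, and it stays
    in \<open>C\<close> because \<open>?c\<close> is in \<open>C\<close>.\<close>
  let ?U = "{y. inverse d *\<^sub>R (y + - ?c) \<in> T interior_of C}"
  have "openin T ?U"
    using openin_continuous_map_preimage
        [OF vector_topology_continuous_map_affine[OF vector_topology] openin_interior_of]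
      vector_topology by (simp add: vector_topology_def)
  moreover have "x \<in> ?U"
    using d interior by simp
  moreover have "?U \<subseteq> C"
  proof
    fix y assume "y \<in> ?U"
    then have "inverse d *\<^sub>R (y + - ?c) \<in> C"
      using interior_of_subset[of T C] by blast
    then have "d *\<^sub>R (inverse d *\<^sub>R (y + - ?c)) \<in> C"
      by (rule cone_scale) (use d in simp)
    then have "y - ?c \<in> C"
      using d(1) by (simp add: algebra_simps)
    from cone_add[OF this d(2)] show "y \<in> C"
      by simp
  qed
  ultimately show "x \<in> T interior_of C"
    using interior_of_maximal[of ?U C T] by blast
qed

lemma norm_interior_of_cone_eq:
  "norm_topology (cone_norm C e) interior_of C = {x. \<exists>d>0. x - d *\<^sub>R e \<in> C}"
  unfolding norm_topology_def cone_metric.metric_interior_of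
proof (intro equalityI subsetI CollectI)
  fix x assume "x \<in> {x \<in> UNIV. \<exists>r>0. cone_metric.mball x r \<subseteq> C}"
  then obtain r where r: "0 < r" "cone_metric.mball x r \<subseteq> C"
    by blast
  \<comment> \<open>Halving \<open>r\<close> keeps the point \<open>x - (r / 2) *\<^sub>R e\<close>
    strictly inside the ball.\<close>
  have "cone_norm C e ((r / 2) *\<^sub>R e) \<le> r / 2"
    using r cone_scale[OF unit_in_cone, of "r / 2 + r / 2"] zero_in_cone
    by (subst cone_norm_le_iff) (simp_all flip: scaleR_add_left)
  then have "x - (r / 2) *\<^sub>R e \<in> cone_metric.mball x r"
    using r(1) by simp
  with r show "\<exists>d>0. x - d *\<^sub>R e \<in> C"
    using half_gt_zero by blast
next
  fix x assume "x \<in> {x. \<exists>d>0. x - d *\<^sub>R e \<in> C}"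
  then obtain d where d: "0 < d" "x - d *\<^sub>R e \<in> C"
    by blast
  \<comment> \<open>The ball of radius \<open>d\<close> works: \<open>y\<close> is the sum of
    \<open>d *\<^sub>R e - (x - y)\<close> and \<open>x - d *\<^sub>R e\<close>.\<close>
  have "y \<in> C" if "cone_norm C e (x - y) < d" for y
    using cone_add[OF cone_norm_less_imp(1)[OF that] d(2)] by simp
  with d(1) show "x \<in> UNIV \<and> (\<exists>r>0. cone_metric.mball x r \<subseteq> C)"
    by auto
qed

end

theorem proposition2p2:
  fixes T :: "'a::real_vector topology" and C :: "'a set"
  assumes "ordered_tvs T C"
    and "solid T C"
  shows "\<exists>e \<in> T interior_of C.
           is_norm (cone_norm C e) \<and>
           monotone_norm C (cone_norm C e) \<and>
           ordering_cone (norm_topology (cone_norm C e)) C \<and>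
           normal (cone_norm C e) C \<and>
           solid (norm_topology (cone_norm C e)) C \<and>
           T interior_of C = norm_topology (cone_norm C e) interior_of C"
proof -
  obtain e where e: "e \<in> T interior_of C"
    using assms(2) by (auto simp: solid_def)
  interpret ordered_tvs_interior_point T C e
    using assms(1) e by unfold_locales
  have interior_eq: "T interior_of C = norm_topology (cone_norm C e) interior_of C"
    by (simp add: interior_of_cone_eq norm_interior_of_cone_eq)
  moreover have "solid (norm_topology (cone_norm C e)) C"
    using assms(2) interior_eq by (simp add: solid_def)
  moreover have "normal (cone_norm C e) C"
    using monotone_cone_norm unfolding normal_def monotone_norm_def
    by (intro exI[of _ 1]) simp
  ultimately show ?thesis
    using e is_norm_cone_norm monotone_cone_norm ordering_cone_norm_topology by blast
qed

end
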